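(* Let $F=(V+r,E)$ be a finite directed graph with root node $r\notin V$ that is a flame, and assume $\varrho_F(r)=0$. Let $m=\max_{v\in V}\varrho_F(v)$, assume $m\ge 1$, and let $V_i=\{v\in V:\varrho_F(v)\ge i\}$ for $i=1,\ldots,m$. Then $E$ can be partitioned into branchings $B_1,B_2,\ldots,B_m$ such that for every $i=1,\ldots,m$ the head-set of $B_i$ is $V_i$ and the spanning subgraph $(V+r,B_1\cup\cdots\cup B_i)$ is a flame.
   Context: For a directed graph $H$ with root $r$ and vertex $v\neq r$, $\lambda_H(r,v)$ denotes the maximum number of pairwise edge-disjoint directed paths from $r$ to $v$ in $H$, and $\varrho_H(v)$ the in-degree of $v$ in $H$. A rooted digraph $H=(V+r,E_H)$ is a flame if $\lambda_H(r,v)=\varrho_H(v)$ for every $v\in V$. A branching is a set $B$ of edges which, disregarding directions, contains no cycle, and such that every vertex is entered by at most one edge of $B$; its head-set is the set of vertices entered by an edge of $B$. *)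

theory Defs
  imports "Graph_Theory.Digraph_Component" "HOL-Library.Disjoint_Sets"
begin

text \<open>Digraphs are those of \<^theory>\<open>Graph_Theory.Digraph\<close>; parallel arcs are allowed.\<close>

definition edge_disjoint_paths :: "('a, 'b) pre_digraph \<Rightarrow> 'a \<Rightarrow> 'a \<Rightarrow> 'b awalk set \<Rightarrow> bool" where
  "edge_disjoint_paths H u v P \<longleftrightarrow>
     (\<forall>p\<in>P. pre_digraph.apath H u p v) \<and> (\<forall>p\<in>P. \<forall>q\<in>P. p \<noteq> q \<longrightarrow> set p \<inter> set q = {})"

text \<open>Only meaningful for finite \<open>H\<close>, where the maximum is over a finite set that contains \<open>0\<close>,
  and for \<open>u \<noteq> v\<close>.\<close>

definition edge_connectivity :: "('a, 'b) pre_digraph \<Rightarrow> 'a \<Rightarrow> 'a \<Rightarrow> nat" where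
  "edge_connectivity H u v = Max {card P | P. finite P \<and> edge_disjoint_paths H u v P}"

definition flame :: "('a, 'b) pre_digraph \<Rightarrow> 'a \<Rightarrow> bool" where
  "flame H r \<longleftrightarrow> fin_digraph H \<and> r \<in> verts H \<and>
     (\<forall>v \<in> verts H - {r}. edge_connectivity H r v = in_degree H v)"

text \<open>Each arc of \<open>B\<close> may be traversed forwards (\<open>True\<close>) or backwards (\<open>False\<close>).\<close>

definition bidirect :: "('a, 'b) pre_digraph \<Rightarrow> 'b set \<Rightarrow> ('a, 'b \<times> bool) pre_digraph" where
  "bidirect G B = \<lparr> verts = verts G, arcs = B \<times> UNIV,
     tail = (\<lambda>(e, fwd). if fwd then tail G e else head G e),
     head = (\<lambda>(e, fwd). if fwd then head G e else tail G e) \<rparr>"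

text \<open>A cycle must not use an arc of \<open>B\<close> twice, so going back and forth along one arc does not
  count, but a loop or a pair of parallel or antiparallel arcs does.\<close>

definition has_undirected_cycle :: "('a, 'b) pre_digraph \<Rightarrow> 'b set \<Rightarrow> bool" where
  "has_undirected_cycle G B \<longleftrightarrow>
     (\<exists>p. pre_digraph.cycle (bidirect G B) p \<and> distinct (map fst p))"

definition branching :: "('a, 'b) pre_digraph \<Rightarrow> 'b set \<Rightarrow> bool" where
  "branching G B \<longleftrightarrow> B \<subseteq> arcs G \<and> \<not> has_undirected_cycle G B \<and>
     (\<forall>e\<in>B. \<forall>f\<in>B. head G e = head G f \<longrightarrow> e = f)"

definition head_set :: "('a, 'b) pre_digraph \<Rightarrow> 'b set \<Rightarrow> 'a set" where
  "head_set G B = head G ` B"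

end

theory Submission
  imports Defs
begin

text \<open>By Menger's theorem, a flame is a digraph in which every set \<open>X\<close> avoiding the root is entered
  by at least \<open>\<varrho>(v)\<close> arcs for each \<open>v \<in> X\<close>. Let \<open>k + 1\<close> be the maximum in-degree and \<open>T\<close> the set
  of vertices attaining it. It suffices to remove from the flame a branching with head-set \<open>T\<close> so
  that every set meeting \<open>T\<close> is still entered by at least \<open>k\<close> arcs. The arcs are removed one at a
  time; with \<open>S \<subseteq> T\<close> the vertices not yet served, each new arc goes from outside \<open>S\<close> into
  \<open>S\<close>, which prevents cycles. It is found inside a minimal tight set meeting \<open>S\<close>, and uncrossing
  shows that it enters no tight set. The same exchange argument, applied to the sets
  containing a fixed vertex, also proves Menger's theorem.\<close>

section \<open>Arcs entering a set\<close>

definition entering :: "('a, 'b) pre_digraph \<Rightarrow> 'b set \<Rightarrow> 'a set \<Rightarrow> 'b set" where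
  "entering G A X = {e \<in> A. head G e \<in> X \<and> tail G e \<notin> X}"

lemma finite_entering: "finite A \<Longrightarrow> finite (entering G A X)"
  by (simp add: entering_def)

text \<open>An arc entering \<open>X \<inter> Y\<close> or \<open>X \<union> Y\<close> enters
  \<open>X\<close> or \<open>Y\<close>, and an arc entering both of the former enters both of the
  latter. Inclusion-exclusion then compares the counts.\<close>

lemma card_entering_submodular:
  assumes "finite A"
  shows "card (entering G A (X \<inter> Y)) + card (entering G A (X \<union> Y))
    \<le> card (entering G A X) + card (entering G A Y)"
proof -
  let ?i = "entering G A (X \<inter> Y)" and ?u = "entering G A (X \<union> Y)"
  let ?x = "entering G A X" and ?y = "entering G A Y"
  have fin: "finite (entering G A Z)" for Z
    using assms by (rule finite_entering)
  have "card ?i + card ?u = card (?i \<union> ?u) + card (?i \<inter> ?u)"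
    by (rule card_Un_Int[OF fin fin])
  also have "\<dots> \<le> card (?x \<union> ?y) + card (?x \<inter> ?y)"
    using fin by (intro add_mono card_mono) (auto simp: entering_def)
  also have "\<dots> = card ?x + card ?y"
    by (rule card_Un_Int[OF fin fin, symmetric])
  finally show ?thesis .
qed

lemma card_entering_remove1:
  assumes "finite A" "e \<in> A"
  shows "card (entering G (A - {e}) X) =
    (if e \<in> entering G A X then card (entering G A X) - 1 else card (entering G A X))"
proof -
  have "entering G (A - {e}) X = entering G A X - {e}"
    by (auto simp: entering_def)
  then show ?thesis
    using assms by (simp add: finite_entering)
qed

lemma uncross_tight:
  assumes "finite A"
    and "k \<le> card (entering G A (X \<inter> Y))" "k \<le> card (entering G A (X \<union> Y))"
    and "card (entering G A X) = k" "card (entering G A Y) = k"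
  shows "card (entering G A (X \<inter> Y)) = k"
  using card_entering_submodular[OF assms(1), of G X Y] assms(2-) by linarith

text \<open>The family \<open>\<C>\<close> is abstract because Menger's theorem uses the sets
  containing a fixed vertex and the peeling uses the sets meeting a fixed set. In both uses
  \<open>gt\<close> holds because the arcs removed earlier have no head in \<open>S\<close>, so
  \<open>X \<inter> S\<close> has lost no entering arc.\<close>

lemma exchange:
  assumes fin: "finite A" "finite W" "\<C> \<subseteq> Pow W"
    and S: "S \<in> \<C>" "S \<noteq> {}"
    and crossing: "\<And>X Y. X \<in> \<C> \<Longrightarrow> Y \<in> \<C> \<Longrightarrow> X \<inter> Y \<inter> S \<noteq> {} \<Longrightarrow> X \<inter> Y \<in> \<C> \<and> X \<union> Y \<in> \<C>"
    and ge: "\<And>X. X \<in> \<C> \<Longrightarrow> k \<le> card (entering G A X)"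
    and gt: "\<And>X. X \<in> \<C> \<Longrightarrow> X \<inter> S \<noteq> {} \<Longrightarrow> k < card (entering G A (X \<inter> S))"
  obtains e where "e \<in> A" "head G e \<in> S" "tail G e \<notin> S"
    "\<And>X. X \<in> \<C> \<Longrightarrow> k \<le> card (entering G (A - {e}) X)"
proof -
  \<comment> \<open>An arc with head in \<open>S\<close> can only enter sets that meet
    \<open>S\<close>, so these are the only tight sets to be avoided.\<close>
  define \<T> where "\<T> = {X \<in> \<C>. X \<inter> S \<noteq> {} \<and> card (entering G A X) = k}"
  have "\<exists>e\<in>A. head G e \<in> S \<and> tail G e \<notin> S \<and> (\<forall>X\<in>\<T>. e \<notin> entering G A X)"
  proof (cases "\<T> = {}")
    case True
    have "k < card (entering G A S)"
      using gt[of S] S by simp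
    then obtain e where "e \<in> entering G A S"
      by (metis card.empty ex_in_conv not_less_zero)
    then show ?thesis
      using True by (auto simp: entering_def)
  next
    case False
    have "\<T> \<subseteq> Pow W"
      using fin(3) by (auto simp: \<T>_def)
    then have "finite \<T>"
      using fin(2) by (meson finite_Pow_iff finite_subset)
    then obtain X where X: "X \<in> \<T>" and min: "\<And>Y. Y \<in> \<T> \<Longrightarrow> Y \<subseteq> X \<Longrightarrow> Y = X"
      using finite_has_minimal[of \<T>] False by metis
    have "card (entering G A X) < card (entering G A (X \<inter> S))"
      using X gt[of X] by (simp add: \<T>_def)
    then have "\<not> entering G A (X \<inter> S) \<subseteq> entering G A X"
      using finite_entering[OF fin(1)] card_mono leD by blast
    \<comment> \<open>An arc that enters \<open>X \<inter> S\<close> but not \<open>X\<close> must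
      start in \<open>X - S\<close>.\<close>
    then obtain e where "e \<in> A" and hd: "head G e \<in> X \<inter> S" and tl: "tail G e \<in> X - S"
      by (auto simp: entering_def)
    moreover have "e \<notin> entering G A Y" if Y: "Y \<in> \<T>" for Y
    proof
      assume "e \<in> entering G A Y"
      then have hdY: "head G e \<in> Y" and tlY: "tail G e \<notin> Y"
        by (auto simp: entering_def)
      have ne: "X \<inter> Y \<inter> S \<noteq> {}"
        using hd hdY by blast
      then have "X \<inter> Y \<in> \<C>" "X \<union> Y \<in> \<C>"
        using crossing X Y by (auto simp: \<T>_def)
      moreover have "card (entering G A (X \<inter> Y)) = k"
        using X Y calculation by (intro uncross_tight fin(1) ge) (auto simp: \<T>_def)
      ultimately have "X \<inter> Y \<in> \<T>"
        using ne by (simp add: \<T>_def)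
      then have "X \<inter> Y = X"
        using min by blast
      \<comment> \<open>Minimality has forced \<open>X\<close> into \<open>Y\<close>, but the tail
        of \<open>e\<close> lies in \<open>X\<close> and outside \<open>Y\<close>.\<close>
      then show False
        using tl tlY by blast
    qed
    ultimately show ?thesis
      by blast
  qed
  then obtain e where e: "e \<in> A" "head G e \<in> S" "tail G e \<notin> S"
    and not: "\<And>X. X \<in> \<T> \<Longrightarrow> e \<notin> entering G A X"
    by blast
  \<comment> \<open>Deleting \<open>e\<close> costs a set at most one entering arc, and every member
    of \<open>\<C>\<close> that \<open>e\<close> enters has one to spare.\<close>
  have "k \<le> card (entering G (A - {e}) X)" if "X \<in> \<C>" for X
  proof (cases "e \<in> entering G A X")
    case True
    then have "X \<inter> S \<noteq> {}" "X \<notin> \<T>"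
      using e not by (auto simp: entering_def)
    then have "k < card (entering G A X)"
      using ge[OF that] that by (auto simp: \<T>_def)
    then show ?thesis
      using True e fin(1) by (simp add: card_entering_remove1)
  next
    case False
    then show ?thesis
      using ge[OF that] e fin(1) by (simp add: card_entering_remove1)
  qed
  with e that show thesis
    by blast
qed

section \<open>Menger's theorem\<close>

text \<open>The induction step of Menger's theorem. A set of arcs reachable from \<open>r\<close> is
  grown by \<open>exchange\<close> until it reaches \<open>t\<close>. A path inside it can then be
  removed, since removing the whole set already leaves \<open>k\<close> arcs in every cut.\<close>

lemma (in fin_digraph) apath_keeping_cuts:
  assumes A: "A \<subseteq> arcs G" and r: "r \<in> verts G" and t: "t \<in> verts G" "t \<noteq> r"
    and cut: "\<And>X. X \<subseteq> verts G - {r} \<Longrightarrow> t \<in> X \<Longrightarrow> Suc k \<le> card (entering G A X)"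
  obtains p where "apath r p t" "set p \<subseteq> A"
    "\<And>X. X \<subseteq> verts G - {r} \<Longrightarrow> t \<in> X \<Longrightarrow> k \<le> card (entering G (A - set p) X)"
proof -
  define \<C> where "\<C> = {X. X \<subseteq> verts G - {r} \<and> t \<in> X}"
  define P where "P B \<longleftrightarrow> B \<subseteq> A \<and> (\<forall>u \<in> insert r (head G ` B). \<exists>p. awalk r p u \<and> set p \<subseteq> B) \<and>
    (\<forall>X\<in>\<C>. k \<le> card (entering G (A - B) X))" for B
  have finA: "finite A"
    using finite_subset[OF A finite_arcs] .
  have "k \<le> card (entering G A X)" if "X \<in> \<C>" for X
    using cut[of X] that by (auto simp: \<C>_def)
  then have "P {}"
    using r by (auto simp: P_def awalk_Nil_iff)
  moreover have "finite {B. P B}"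
    by (rule finite_subset[of _ "Pow A"]) (auto simp: P_def finA)
  ultimately obtain B where B: "P B" and max: "\<And>B'. P B' \<Longrightarrow> B \<subseteq> B' \<Longrightarrow> B' = B"
    using finite_has_maximal[of "{B. P B}"] by (metis empty_iff mem_Collect_eq)
  have BA: "B \<subseteq> A" and reach: "\<And>u. u \<in> insert r (head G ` B) \<Longrightarrow> \<exists>p. awalk r p u \<and> set p \<subseteq> B"
    and cutB: "\<And>X. X \<in> \<C> \<Longrightarrow> k \<le> card (entering G (A - B) X)"
    using B by (auto simp: P_def)
  have "t \<in> head G ` B"
  proof (rule ccontr)
    assume tB: "t \<notin> head G ` B"
    \<comment> \<open>The vertices not yet reached. No arc of \<open>B\<close> enters a subset of
      \<open>S\<close>, so such a subset containing \<open>t\<close> keeps its \<open>Suc k\<close>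
      arcs.\<close>
    define S where "S = verts G - {r} - head G ` B"
    have "Suc k \<le> card (entering G (A - B) (X \<inter> S))" if "X \<in> \<C>" for X
    proof -
      have "entering G (A - B) (X \<inter> S) = entering G A (X \<inter> S)"
        by (auto simp: entering_def S_def)
      moreover have "X \<inter> S \<subseteq> verts G - {r}" "t \<in> X \<inter> S"
        using that tB t by (auto simp: \<C>_def S_def)
      ultimately show ?thesis
        using cut by metis
    qed
    \<comment> \<open>All members of \<open>\<C>\<close> contain \<open>t\<close>, so
      \<open>\<C>\<close> is closed under intersection and union. The new arc leaves a reached
      vertex, which preserves reachability.\<close>
    then obtain e where e: "e \<in> A - B" "head G e \<in> S" "tail G e \<notin> S"
      and cut_e: "\<And>X. X \<in> \<C> \<Longrightarrow> k \<le> card (entering G (A - B - {e}) X)"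
      by (rule_tac exchange[of "A - B" "verts G" \<C> S k G])
        (use finA tB t cutB in \<open>auto simp: \<C>_def S_def less_eq_Suc_le\<close>)
    have eG: "e \<in> arcs G"
      using e A by blast
    then have "tail G e \<in> insert r (head G ` B)"
      using e by (auto simp: S_def)
    then obtain p where p: "awalk r p (tail G e)" "set p \<subseteq> B"
      using reach by blast
    then have "awalk r (p @ [e]) (head G e)"
      using eG by (auto simp: awalk_simps)
    moreover have "set (p @ [e]) \<subseteq> insert e B"
      using p by auto
    ultimately have "\<exists>q. awalk r q (head G e) \<and> set q \<subseteq> insert e B"
      by blast
    then have "\<exists>q. awalk r q u \<and> set q \<subseteq> insert e B"
      if "u \<in> insert r (head G ` insert e B)" for u
      using reach[of u] that by blast
    moreover have "A - insert e B = A - B - {e}"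
      by blast
    ultimately have "P (insert e B)"
      using e BA cut_e unfolding P_def by simp
    with max[of "insert e B"] e show False
      by blast
  qed
  then obtain q where q: "awalk r q t" "set q \<subseteq> B"
    using reach by blast
  define p where "p = awalk_to_apath q"
  have "apath r p t" "set p \<subseteq> B"
    using q apath_awalk_to_apath awalk_to_apath_subset unfolding p_def by blast+
  moreover have "k \<le> card (entering G (A - set p) X)" if "X \<subseteq> verts G - {r}" "t \<in> X" for X
  proof -
    have "k \<le> card (entering G (A - B) X)"
      using cutB that by (simp add: \<C>_def)
    also have "\<dots> \<le> card (entering G (A - set p) X)"
      using finA calculation \<open>set p \<subseteq> B\<close> by (intro card_mono finite_entering) (auto simp: entering_def)
    finally show ?thesis .
  qed
  ultimately show thesis
    using that BA by blast
qed

text \<open>The hard half of Menger's theorem, by splitting off one path at a time. Confining the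
  paths to \<open>A\<close> lets \<open>A\<close> shrink in the induction while the digraph stays
  fixed.\<close>

lemma (in fin_digraph) edge_disjoint_paths_of_cuts:
  assumes "A \<subseteq> arcs G" "r \<in> verts G" "t \<in> verts G" "t \<noteq> r"
    and "\<And>X. X \<subseteq> verts G - {r} \<Longrightarrow> t \<in> X \<Longrightarrow> k \<le> card (entering G A X)"
  shows "\<exists>P. finite P \<and> card P = k \<and> edge_disjoint_paths G r t P \<and> (\<forall>p\<in>P. set p \<subseteq> A)"
  using assms
proof (induction k arbitrary: A)
  case 0
  show ?case
    by (intro exI[of _ "{}"]) (simp add: edge_disjoint_paths_def)
next
  case (Suc k)
  obtain p where p: "apath r p t" "set p \<subseteq> A"
    and cut: "\<And>X. X \<subseteq> verts G - {r} \<Longrightarrow> t \<in> X \<Longrightarrow> k \<le> card (entering G (A - set p) X)"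
    using apath_keeping_cuts[OF Suc.prems] by blast
  obtain P where P: "finite P" "card P = k" "edge_disjoint_paths G r t P"
    "\<forall>q\<in>P. set q \<subseteq> A - set p"
    using Suc.IH[of "A - set p"] Suc.prems cut by blast
  \<comment> \<open>An empty path would be arc-disjoint from itself. Nonemptiness ensures that
    \<open>p\<close> is not already in \<open>P\<close>.\<close>
  have "p \<noteq> []"
    using p(1) \<open>t \<noteq> r\<close> by (auto simp: apath_Nil_iff)
  then have "p \<notin> P"
    using P(4) by (cases p) auto
  then have "card (insert p P) = Suc k"
    using P by simp
  moreover have "edge_disjoint_paths G r t (insert p P)"
    using P p unfolding edge_disjoint_paths_def by blast
  ultimately show ?case
    using P p by (intro exI[of _ "insert p P"]) auto
qed

lemma (in pre_digraph) cas_enters: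
  assumes "cas u p v" "u \<notin> X" "v \<in> X"
  shows "\<exists>e \<in> set p. tail G e \<notin> X \<and> head G e \<in> X"
  using assms by (induction u p v rule: cas.induct) auto

text \<open>The easy half of Menger's theorem: each path has an arc entering \<open>X\<close>, and
  choosing one per path is injective because distinct paths share no arc.\<close>

lemma (in fin_digraph) card_edge_disjoint_paths_le:
  assumes P: "edge_disjoint_paths G r v P" and X: "r \<notin> X" "v \<in> X"
  shows "finite P \<and> card P \<le> card (entering G (arcs G) X)"
proof -
  have "\<exists>e. e \<in> set p \<and> e \<in> entering G (arcs G) X" if "p \<in> P" for p
  proof -
    have "cas r p v" "set p \<subseteq> arcs G"
      using P that by (auto simp: edge_disjoint_paths_def apath_def awalk_def)
    then show ?thesis
      using cas_enters[of r p v X] X by (auto simp: entering_def)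
  qed
  then obtain f where f: "\<And>p. p \<in> P \<Longrightarrow> f p \<in> set p \<and> f p \<in> entering G (arcs G) X"
    by metis
  then have "inj_on f P"
    using P unfolding edge_disjoint_paths_def inj_on_def by (metis disjoint_iff)
  moreover have "f ` P \<subseteq> entering G (arcs G) X"
    using f by blast
  ultimately show ?thesis
    using card_inj_on_le inj_on_finite finite_entering[OF finite_arcs] by metis
qed

section \<open>Connectivity and flames in terms of cuts\<close>

lemma (in fin_digraph) le_edge_connectivity_iff:
  assumes "r \<in> verts G" "v \<in> verts G" "v \<noteq> r"
  shows "k \<le> edge_connectivity G r v \<longleftrightarrow>
    (\<forall>X. X \<subseteq> verts G - {r} \<longrightarrow> v \<in> X \<longrightarrow> k \<le> card (entering G (arcs G) X))"
proof -
  let ?N = "{card P | P. finite P \<and> edge_disjoint_paths G r v P}"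
  \<comment> \<open>The cut \<open>{v}\<close> bounds all path families, so \<open>Max\<close> is
    taken over a finite set.\<close>
  have "?N \<subseteq> {..card (entering G (arcs G) {v})}"
    using card_edge_disjoint_paths_le[of r v _ "{v}"] assms by auto
  then have fin: "finite ?N"
    using finite_subset by blast
  have "0 \<in> ?N"
    by (auto simp: edge_disjoint_paths_def intro!: exI[of _ "{}"])
  then have "edge_connectivity G r v \<in> ?N"
    unfolding edge_connectivity_def using Max_in[OF fin] by blast
  moreover have "n \<le> edge_connectivity G r v" if "n \<in> ?N" for n
    unfolding edge_connectivity_def using Max_ge[OF fin that] .
  ultimately show ?thesis
    using card_edge_disjoint_paths_le[of r v] edge_disjoint_paths_of_cuts[OF subset_refl assms, of k]
    by (smt (verit) DiffE insertI1 le_trans mem_Collect_eq subsetD)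
qed

text \<open>Relative to an arc set, so that \<open>G\<close> can stay fixed while arcs are
  removed.\<close>

definition indeg :: "('a, 'b) pre_digraph \<Rightarrow> 'b set \<Rightarrow> 'a \<Rightarrow> nat" where
  "indeg G A v = card {e \<in> A. head G e = v}"

lemma in_degree_eq_indeg: "in_degree G v = indeg G (arcs G) v"
  by (simp add: in_degree_def in_arcs_def indeg_def)

definition cut_flame :: "('a, 'b) pre_digraph \<Rightarrow> 'a \<Rightarrow> 'b set \<Rightarrow> bool" where
  "cut_flame G r A \<longleftrightarrow>
    (\<forall>X \<subseteq> verts G - {r}. \<forall>v\<in>X. indeg G A v \<le> card (entering G A X))"

text \<open>The cut \<open>{v}\<close> shows that connectivity never exceeds the in-degree. Being a
  flame is therefore only the reverse inequality, which Menger's theorem turns into a bound on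
  cuts.\<close>

lemma (in fin_digraph) flame_iff_cut_flame:
  assumes r: "r \<in> verts G"
  shows "flame G r \<longleftrightarrow> cut_flame G r (arcs G)"
proof -
  have "edge_connectivity G r v \<le> in_degree G v" if "v \<in> verts G - {r}" for v
  proof -
    have "edge_connectivity G r v \<le> card (entering G (arcs G) {v})"
      using le_edge_connectivity_iff[of r v "edge_connectivity G r v"] r that by auto
    also have "\<dots> \<le> in_degree G v"
      unfolding in_degree_def by (rule card_mono) (auto simp: entering_def)
    finally show ?thesis .
  qed
  then have "edge_connectivity G r v = in_degree G v \<longleftrightarrow> in_degree G v \<le> edge_connectivity G r v"
    if "v \<in> verts G - {r}" for v
    using that by (metis le_antisym order_refl)
  then have "flame G r \<longleftrightarrow> (\<forall>v \<in> verts G - {r}. in_degree G v \<le> edge_connectivity G r v)"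
    using r fin_digraph_axioms by (simp add: flame_def)
  also have "\<dots> \<longleftrightarrow> (\<forall>v \<in> verts G - {r}. \<forall>X. X \<subseteq> verts G - {r} \<longrightarrow> v \<in> X \<longrightarrow>
      in_degree G v \<le> card (entering G (arcs G) X))"
    using le_edge_connectivity_iff[OF r] by (intro ball_cong refl) simp
  also have "\<dots> \<longleftrightarrow> cut_flame G r (arcs G)"
    unfolding cut_flame_def in_degree_eq_indeg by (meson subsetD)
  finally show ?thesis .
qed

lemma (in fin_digraph) flame_arcs_iff_cut_flame:
  assumes "r \<in> verts G" "A \<subseteq> arcs G"
  shows "flame (G\<lparr>arcs := A\<rparr>) r \<longleftrightarrow> cut_flame G r A"
proof -
  have "finite A"
    using finite_subset[OF assms(2) finite_arcs] .
  then interpret H: fin_digraph "G\<lparr>arcs := A\<rparr>"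
    using assms by unfold_locales auto
  show ?thesis
    using H.flame_iff_cut_flame assms by (simp add: cut_flame_def indeg_def entering_def)
qed

section \<open>Peeling off a branching\<close>

lemma (in pre_digraph) cas_insert_heads_tails:
  "cas u p v \<Longrightarrow> insert v (tail G ` set p) = insert u (head G ` set p)"
proof (induction p arbitrary: u)
  case (Cons e p)
  then have IH: "insert v (tail G ` set p) = insert (head G e) (head G ` set p)" and "tail G e = u"
    by simp_all
  have "insert v (tail G ` set (e # p)) = insert (tail G e) (insert v (tail G ` set p))"
    by (simp only: list.set image_insert insert_commute)
  also have "\<dots> = insert u (head G ` set (e # p))"
    by (simp only: IH list.set image_insert \<open>tail G e = u\<close>)
  finally show ?case .
qed simp

lemma (in pre_digraph) cas_last_in_heads:
  "cas u p v \<Longrightarrow> p \<noteq> [] \<Longrightarrow> v \<in> head G ` set p"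
proof (induction p arbitrary: u)
  case (Cons e p)
  then show ?case
    by (cases "p = []") auto
qed simp

text \<open>Along a walk the heads and tails can differ only at the two ends. These coincide in a
  cycle and belong to both sets.\<close>

lemma (in pre_digraph) cycle_heads_eq_tails:
  assumes "cycle p"
  shows "head G ` set p = tail G ` set p"
proof -
  obtain u where u: "cas u p u" "p \<noteq> []"
    using assms by (auto simp: cycle_def awalk_def)
  have "u \<in> tail G ` set p"
    using u by (cases p) auto
  moreover have "u \<in> head G ` set p"
    using cas_last_in_heads u by metis
  ultimately show ?thesis
    using cas_insert_heads_tails[OF u(1)] insert_absorb by metis
qed

text \<open>No arc of \<open>B\<close> touches \<open>head G e\<close>, so a cycle through
  \<open>e\<close> would have to enter and leave this vertex by \<open>e\<close> alone. It uses
  \<open>e\<close> only once, and \<open>e\<close> is not a loop.\<close>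

lemma has_undirected_cycle_insert_pendant:
  assumes "has_undirected_cycle G (insert e B)" "tail G e \<noteq> head G e"
    and "head G e \<notin> head G ` B" "head G e \<notin> tail G ` B"
  shows "has_undirected_cycle G B"
proof -
  let ?G = "bidirect G (insert e B)"
  obtain p where p: "pre_digraph.cycle ?G p" "distinct (map fst p)"
    using assms(1) by (auto simp: has_undirected_cycle_def)
  have sub: "set p \<subseteq> insert e B \<times> UNIV"
    using p(1) by (auto simp: pre_digraph.cycle_def pre_digraph.awalk_def bidirect_def)
  have inj: "inj_on fst (set p)"
    using p(2) by (simp add: distinct_map)
  have only: "fst y = e" if "y \<in> set p" "head ?G y = head G e \<or> tail ?G y = head G e" for y
  proof (rule ccontr)
    assume "fst y \<noteq> e"
    then have "fst y \<in> B"
      using that(1) sub by auto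
    then show False
      using that(2) assms(3,4) unfolding image_iff
      by (auto simp: bidirect_def split: if_splits prod.splits)
  qed
  have "(e, c) \<notin> set p" for c
  proof
    assume ep: "(e, c) \<in> set p"
    then have uniq: "y = (e, c)" if "y \<in> set p" "fst y = e" for y
      using inj that by (auto simp: inj_on_def)
    have eq: "head ?G ` set p = tail ?G ` set p"
      using p(1) by (rule pre_digraph.cycle_heads_eq_tails)
    have "head G e \<in> head ?G ` set p \<or> head G e \<in> tail ?G ` set p"
      using ep by (cases c) (force simp: bidirect_def)+
    then have "head G e \<in> head ?G ` set p" "head G e \<in> tail ?G ` set p"
      using eq by auto
    then obtain y z where yz: "y \<in> set p" "head ?G y = head G e" "z \<in> set p" "tail ?G z = head G e"
      unfolding image_iff by metis
    then have "y = (e, c)" "z = (e, c)"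
      using only uniq by blast+
    with yz have "head ?G (e, c) = head G e" "tail ?G (e, c) = head G e"
      by simp_all
    then show False
      using assms(2) by (cases c) (auto simp: bidirect_def)
  qed
  then have "set p \<subseteq> B \<times> UNIV"
    using sub by auto
  \<comment> \<open>These functions see only \<open>tail\<close> and \<open>head\<close>, which
    \<open>bidirect\<close> defines independently of the arc set.\<close>
  moreover have "pre_digraph.awalk_verts ?G u q = pre_digraph.awalk_verts (bidirect G B) u q"
    "pre_digraph.cas ?G u q v = pre_digraph.cas (bidirect G B) u q v" for u q v
    by (induction q arbitrary: u)
      (simp_all add: pre_digraph.awalk_verts.simps pre_digraph.cas.simps bidirect_def)
  ultimately have "pre_digraph.cycle (bidirect G B) p"
    using p(1) by (auto simp: pre_digraph.cycle_def pre_digraph.awalk_def bidirect_def)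
  then show ?thesis
    using p(2) by (auto simp: has_undirected_cycle_def)
qed

lemma not_has_undirected_cycle_empty: "\<not> has_undirected_cycle G {}"
  by (auto simp: has_undirected_cycle_def pre_digraph.cycle_def pre_digraph.awalk_def bidirect_def)

lemma indeg_diff_inj:
  assumes "finite A" "B \<subseteq> A" "inj_on (head G) B"
  shows "indeg G (A - B) v = indeg G A v - (if v \<in> head G ` B then 1 else 0)"
proof -
  have eq: "{e \<in> A - B. head G e = v} = {e \<in> A. head G e = v} - {e \<in> B. head G e = v}"
    by auto
  have sub: "{e \<in> B. head G e = v} \<subseteq> {e \<in> A. head G e = v}"
    using assms by auto
  have fin: "finite {e \<in> B. head G e = v}"
    using assms(1,2) by (simp add: finite_subset)
  have "card {e \<in> B. head G e = v} = (if v \<in> head G ` B then 1 else 0)"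
  proof (cases "v \<in> head G ` B")
    case True
    then obtain e where "e \<in> B" "v = head G e"
      by blast
    then have "{e \<in> B. head G e = v} = {e}"
      using assms(3) by (auto simp: inj_on_def)
    then show ?thesis
      using True by simp
  next
    case False
    then have none: "{e \<in> B. head G e = v} = {}"
      by auto
    show ?thesis
      unfolding none using False by simp
  qed
  then show ?thesis
    unfolding indeg_def eq by (simp add: card_Diff_subset[OF fin sub])
qed

text \<open>Afterwards all in-degrees outside the root are at most \<open>k\<close>, so
  \<open>k\<close> entering arcs suffice for sets meeting \<open>T\<close>. Sets disjoint from
  \<open>T\<close> are entered by no arc of \<open>B\<close> and lose nothing.\<close>

lemma (in fin_digraph) peel_branching:
  assumes A: "A \<subseteq> arcs G" and flame: "cut_flame G r A"
    and deg: "\<And>v. v \<in> verts G - {r} \<Longrightarrow> indeg G A v \<le> Suc k"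
  obtains B where "B \<subseteq> A" "inj_on (head G) B" "\<not> has_undirected_cycle G B"
    "head G ` B = {v \<in> verts G - {r}. indeg G A v = Suc k}" "cut_flame G r (A - B)"
proof -
  define T where "T = {v \<in> verts G - {r}. indeg G A v = Suc k}"
  define \<C> where "\<C> = {X. X \<subseteq> verts G - {r} \<and> X \<inter> T \<noteq> {}}"
  \<comment> \<open>The condition on tails says that no chosen arc starts at an unserved vertex of
    \<open>T\<close>. The head of the next arc is thus untouched by \<open>B\<close>, and the arc is
    pendant.\<close>
  define P where "P B \<longleftrightarrow> B \<subseteq> A \<and> inj_on (head G) B \<and> head G ` B \<subseteq> T \<and>
    tail G ` B \<inter> (T - head G ` B) = {} \<and> \<not> has_undirected_cycle G B \<and>
    (\<forall>X\<in>\<C>. k \<le> card (entering G (A - B) X))" for B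
  have finA: "finite A"
    using finite_subset[OF A finite_arcs] .
  have cutA: "Suc k \<le> card (entering G A X)" if X: "X \<in> \<C>" for X
  proof -
    obtain v where "v \<in> X" "indeg G A v = Suc k"
      using X unfolding \<C>_def T_def by blast
    moreover have "X \<subseteq> verts G - {r}"
      using X by (simp add: \<C>_def)
    ultimately show ?thesis
      using flame unfolding cut_flame_def by metis
  qed
  have "k \<le> card (entering G A X)" if "X \<in> \<C>" for X
    using cutA[OF that] by (rule Suc_leD)
  then have "P {}"
    by (simp add: P_def not_has_undirected_cycle_empty)
  moreover have "finite {B. P B}"
    by (rule finite_subset[of _ "Pow A"]) (auto simp: P_def finA)
  ultimately obtain B where B: "P B" and max: "\<And>B'. P B' \<Longrightarrow> B \<subseteq> B' \<Longrightarrow> B' = B"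
    using finite_has_maximal[of "{B. P B}"] by (metis empty_iff mem_Collect_eq)
  have BA: "B \<subseteq> A" and inj: "inj_on (head G) B" and heads: "head G ` B \<subseteq> T"
    and tails: "tail G ` B \<inter> (T - head G ` B) = {}" and acyc: "\<not> has_undirected_cycle G B"
    and cutB: "\<And>X. X \<in> \<C> \<Longrightarrow> k \<le> card (entering G (A - B) X)"
    using B by (auto simp: P_def)
  have T: "head G ` B = T"
  proof (rule ccontr)
    assume neq: "head G ` B \<noteq> T"
    define S where "S = T - head G ` B"
    have "Suc k \<le> card (entering G (A - B) (X \<inter> S))" if "X \<in> \<C>" "X \<inter> S \<noteq> {}" for X
    proof -
      have "entering G (A - B) (X \<inter> S) = entering G A (X \<inter> S)"
        by (auto simp: entering_def S_def)
      moreover have "X \<inter> S \<in> \<C>"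
        using that by (auto simp: \<C>_def S_def)
      ultimately show ?thesis
        using cutA by metis
    qed
    \<comment> \<open>Since \<open>S\<close> is contained in \<open>T\<close>, sets that intersect
      inside \<open>S\<close> have their intersection and union in \<open>\<C>\<close>.\<close>
    then obtain e where e: "e \<in> A - B" "head G e \<in> S" "tail G e \<notin> S"
      and cut_e: "\<And>X. X \<in> \<C> \<Longrightarrow> k \<le> card (entering G (A - B - {e}) X)"
      by (rule_tac exchange[of "A - B" "verts G" \<C> S k G])
        (use finA neq heads cutB in \<open>auto simp: \<C>_def S_def T_def less_eq_Suc_le\<close>)
    have S_T: "S \<subseteq> T" and S_heads: "head G e \<notin> head G ` B" and S_tails: "head G e \<notin> tail G ` B"
      using e(2) tails unfolding S_def by blast+
    have "tail G e \<noteq> head G e"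
      using e by metis
    then have "\<not> has_undirected_cycle G (insert e B)"
      using has_undirected_cycle_insert_pendant[of G e B] acyc S_heads S_tails by blast
    moreover have "A - insert e B = A - B - {e}"
      by blast
    moreover have "tail G ` insert e B \<inter> (T - head G ` insert e B) = {}"
      using tails e(3) unfolding S_def by blast
    moreover have "inj_on (head G) (insert e B)"
      using inj S_heads e(1) by simp
    moreover have "insert e B \<subseteq> A" "head G ` insert e B \<subseteq> T"
      using e(1,2) BA heads S_T by blast+
    ultimately have "P (insert e B)"
      using cut_e unfolding P_def by metis
    with max[of "insert e B"] e show False
      by blast
  qed
  have "indeg G (A - B) v \<le> card (entering G (A - B) X)" if X: "X \<subseteq> verts G - {r}" "v \<in> X" for X v
  proof (cases "X \<inter> T = {}")
    case True
    then have "head G e \<notin> X" if "e \<in> B" for e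
      using T that by blast
    then have "entering G (A - B) X = entering G A X"
      by (auto simp: entering_def)
    moreover have "indeg G (A - B) v \<le> indeg G A v"
      using indeg_diff_inj[OF finA BA inj] by simp
    moreover have "indeg G A v \<le> card (entering G A X)"
      using flame X unfolding cut_flame_def by blast
    ultimately show ?thesis
      by simp
  next
    case False
    have "v \<in> verts G - {r}"
      using X by blast
    then have "indeg G (A - B) v \<le> k"
      using deg[of v] indeg_diff_inj[OF finA BA inj, of v] T by (auto simp: T_def split: if_splits)
    also have "k \<le> card (entering G (A - B) X)"
      using False X cutB by (auto simp: \<C>_def)
    finally show ?thesis .
  qed
  then have "cut_flame G r (A - B)"
    by (auto simp: cut_flame_def)
  then show thesis
    using that BA inj acyc T by (simp add: T_def)
qed

section \<open>Decomposition by induction on a bound for the in-degrees\<close>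

definition branching_layers ::
    "('a, 'b) pre_digraph \<Rightarrow> 'a \<Rightarrow> 'b set \<Rightarrow> nat \<Rightarrow> (nat \<Rightarrow> 'b set) \<Rightarrow> bool" where
  "branching_layers G r A m B \<longleftrightarrow>
    (\<Union>i\<in>{1..m}. B i) = A \<and> disjoint_family_on B {1..m} \<and>
    (\<forall>i\<in>{1..m}. inj_on (head G) (B i) \<and> \<not> has_undirected_cycle G (B i) \<and>
      head G ` B i = {v \<in> verts G - {r}. i \<le> indeg G A v} \<and> cut_flame G r (\<Union>j\<in>{1..i}. B j))"

text \<open>The branching peeled off first becomes the last layer, so the unions of initial layers
  are exactly the flames left after successive peelings.\<close>

lemma (in fin_digraph) branching_decomposition:
  assumes "A \<subseteq> arcs G" "cut_flame G r A" "indeg G A r = 0"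
    and "\<And>v. v \<in> verts G - {r} \<Longrightarrow> indeg G A v \<le> m"
  shows "\<exists>B. branching_layers G r A m B"
  using assms
proof (induction m arbitrary: A)
  case 0
  have "finite A"
    using finite_subset[OF 0(1) finite_arcs] .
  \<comment> \<open>No arc can enter the root, and the bound \<open>0\<close> excludes arcs into the
    other vertices.\<close>
  have "A = {}"
  proof (rule ccontr)
    assume "A \<noteq> {}"
    then obtain e where e: "e \<in> A"
      by blast
    then have "indeg G A (head G e) \<noteq> 0"
      using \<open>finite A\<close> by (auto simp: indeg_def)
    moreover have "head G e \<in> verts G"
      using e 0(1) by auto
    ultimately show False
      using 0(3) 0(4)[of "head G e"] by (cases "head G e = r") auto
  qed
  then show ?case
    by (simp add: branching_layers_def disjoint_family_on_def)
next
  case (Suc m)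
  have fin: "finite A"
    using finite_subset[OF Suc.prems(1) finite_arcs] .
  obtain B' where B': "B' \<subseteq> A" "inj_on (head G) B'" "\<not> has_undirected_cycle G B'"
    "head G ` B' = {v \<in> verts G - {r}. indeg G A v = Suc m}" "cut_flame G r (A - B')"
    using peel_branching[OF Suc.prems(1,2,4)] by blast
  have deg: "indeg G (A - B') v = (if indeg G A v = Suc m then m else indeg G A v)"
    if "v \<in> verts G - {r}" for v
    using indeg_diff_inj[OF fin B'(1,2), of v] that B'(4) by auto
  have "indeg G (A - B') r = 0"
    using Suc.prems(3) indeg_diff_inj[OF fin B'(1,2), of r] by simp
  moreover have "indeg G (A - B') v \<le> m" if "v \<in> verts G - {r}" for v
    using deg[OF that] Suc.prems(4)[OF that] by auto
  moreover have "A - B' \<subseteq> arcs G"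
    using Suc.prems(1) by blast
  ultimately obtain B where "branching_layers G r (A - B') m B"
    using Suc.IH B'(5) by metis
  then have B: "(\<Union>i\<in>{1..m}. B i) = A - B'" "disjoint_family_on B {1..m}"
    and Bi: "\<And>i. i \<in> {1..m} \<Longrightarrow> inj_on (head G) (B i) \<and> \<not> has_undirected_cycle G (B i) \<and>
      head G ` B i = {v \<in> verts G - {r}. i \<le> indeg G (A - B') v} \<and>
      cut_flame G r (\<Union>j\<in>{1..i}. B j)"
    unfolding branching_layers_def by blast+
  define C where "C = B(Suc m := B')"
  have C_old: "C i = B i" if "i \<in> {1..m}" for i
    using that by (simp add: C_def)
  have C_new: "C (Suc m) = B'"
    by (simp add: C_def)
  have split: "{1..Suc m} = insert (Suc m) {1..m}"
    by auto
  have C_Un: "(\<Union>j\<in>{1..i}. C j) = (\<Union>j\<in>{1..i}. B j)" if "i \<le> m" for i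
    using that by (auto simp: C_def)
  have un: "(\<Union>i\<in>{1..Suc m}. C i) = A"
    unfolding split using C_Un[of m] C_new B(1) B'(1) by auto
  moreover have "disjoint_family_on C {1..Suc m}"
  proof -
    have "disjoint_family_on C {1..m}"
      using B(2) C_old by (simp add: disjoint_family_on_def)
    moreover have "C (Suc m) \<inter> (\<Union>i\<in>{1..m}. C i) = {}"
      using C_new C_Un[of m] B(1) by auto
    ultimately show ?thesis
      unfolding split by (simp add: disjoint_family_on_insert)
  qed
  moreover have "inj_on (head G) (C i) \<and> \<not> has_undirected_cycle G (C i) \<and>
      head G ` C i = {v \<in> verts G - {r}. i \<le> indeg G A v} \<and> cut_flame G r (\<Union>j\<in>{1..i}. C j)"
    if i: "i \<in> {1..Suc m}" for i
  proof (cases "i = Suc m")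
    case True
    \<comment> \<open>Peeling serves the vertices of in-degree exactly \<open>Suc m\<close>. As this
      is the upper bound, they form the required threshold set.\<close>
    have "{v \<in> verts G - {r}. indeg G A v = Suc m} = {v \<in> verts G - {r}. Suc m \<le> indeg G A v}"
      using Suc.prems(4) by (auto intro: le_antisym)
    then show ?thesis
      using True B' un Suc.prems(2) C_new by simp
  next
    case False
    then have i': "i \<in> {1..m}"
      using i by auto
    \<comment> \<open>Only in-degrees equal to \<open>Suc m\<close> drop, and they drop to
      \<open>m\<close>, which is still at least \<open>i\<close>.\<close>
    have "{v \<in> verts G - {r}. i \<le> indeg G (A - B') v} = {v \<in> verts G - {r}. i \<le> indeg G A v}"
      using deg i' by (auto split: if_splits)
    then show ?thesis
      using Bi[OF i'] C_old[OF i'] C_Un[of i] i' by simp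
  qed
  ultimately have "branching_layers G r A (Suc m) C"
    unfolding branching_layers_def by blast
  then show ?case
    by blast
qed

theorem theorem7:
  fixes F :: "('a, 'b) pre_digraph" and V :: "'a set" and r :: 'a and m :: nat
    and Vi :: "nat \<Rightarrow> 'a set"
  assumes "fin_digraph F"
    and "r \<notin> V" and "verts F = insert r V" and "V \<noteq> {}"
    and "flame F r"
    and "in_degree F r = 0"
    and "m = Max (in_degree F ` V)" and "m \<ge> 1"
    and "\<And>i. Vi i = {v \<in> V. in_degree F v \<ge> i}"
  shows "\<exists>B :: nat \<Rightarrow> 'b set.
      (\<Union>i\<in>{1..m}. B i) = arcs F \<and>
      disjoint_family_on B {1..m} \<and>
      (\<forall>i\<in>{1..m}. branching F (B i) \<and> head_set F (B i) = Vi i \<and>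
         flame (F\<lparr>arcs := (\<Union>j\<in>{1..i}. B j)\<rparr>) r)"
proof -
  interpret F: fin_digraph F
    by fact
  have r: "r \<in> verts F" and V: "verts F - {r} = V"
    using assms by auto
  have "finite V"
    using F.finite_verts assms(3) by simp
  then have "in_degree F v \<le> m" if "v \<in> V" for v
    using that assms(7) by simp
  then obtain B where "branching_layers F r (arcs F) m B"
    using F.branching_decomposition[of "arcs F" r m] F.flame_iff_cut_flame[OF r] assms(5,6)
    unfolding V in_degree_eq_indeg by blast
  then have B: "(\<Union>i\<in>{1..m}. B i) = arcs F" "disjoint_family_on B {1..m}"
    and Bi: "\<And>i. i \<in> {1..m} \<Longrightarrow> inj_on (head F) (B i) \<and> \<not> has_undirected_cycle F (B i) \<and>
      head F ` B i = {v \<in> V. i \<le> indeg F (arcs F) v} \<and> cut_flame F r (\<Union>j\<in>{1..i}. B j)"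
    unfolding branching_layers_def V by blast+
  have "branching F (B i) \<and> head_set F (B i) = Vi i \<and>
      flame (F\<lparr>arcs := (\<Union>j\<in>{1..i}. B j)\<rparr>) r" if i: "i \<in> {1..m}" for i
  proof -
    \<comment> \<open>Every initial union consists of arcs of \<open>F\<close>, so the cut condition
      translates back into a flame on the spanning subgraph.\<close>
    have "(\<Union>j\<in>{1..i}. B j) \<subseteq> (\<Union>j\<in>{1..m}. B j)"
      using i by (intro UN_mono) auto
    then have "(\<Union>j\<in>{1..i}. B j) \<subseteq> arcs F"
      using B(1) by simp
    moreover have "B i \<subseteq> arcs F"
      using B(1) i by blast
    ultimately show ?thesis
      using Bi[OF i] F.flame_arcs_iff_cut_flame[OF r] assms(9)[of i]
      by (auto simp: branching_def head_set_def in_degree_eq_indeg inj_on_def)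
  qed
  with B show ?thesis
    by blast
qed

end
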